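(* Consider the stealth attack problem (defined in the context) for a map $\mathcal{F}:\mathbb{B}_n\to\mathbb{R}$, a finite verification set $\mathcal{V}\subset\mathbb{B}_n$ of cardinality at most $M$, and given $\varepsilon>0$, $\Delta>0$, with $g$ being either the ReLU function or the sigmoid. Let $\boldsymbol{x}'$ be a vector that is randomly drawn from the equidistribution (uniform distribution) in $\mathbb{B}_n$. Then the probability that $$\mathfrak{A}(\cdot,(\kappa\boldsymbol{x}',b))=D\,g\big((\cdot,\kappa\boldsymbol{x}')-b\big),\qquad b=\kappa\left(\frac{1+\gamma}{2}\right)\|\boldsymbol{x}'\|^2,$$ where $\kappa$ and $D$ are chosen so that $$D\,g\left(-\kappa\frac{1-\gamma}{2}\|\boldsymbol{x}'\|^2\right)\le\varepsilon\quad\text{and}\quad D\,g\left(\kappa\frac{1-\gamma}{2}\|\boldsymbol{x}'\|^2\right)\ge\Delta,\qquad \gamma\in(0,1),$$ is a solution of the stealth attack problem with target $\boldsymbol{x}'$ is at least $$1-M\left(\frac{1}{2\gamma}\right)^n .$$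
   Context: $(\boldsymbol{x},\boldsymbol{y})=\sum_k x_ky_k$ is the inner product and $\|\boldsymbol{x}\|=\sqrt{(\boldsymbol{x},\boldsymbol{x})}$ the Euclidean norm on $\mathbb{R}^n$; $\mathbb{B}_n=\{\boldsymbol{x}\in\mathbb{R}^n:\|\boldsymbol{x}\|\le1\}$. The function $g:\mathbb{R}\to\mathbb{R}$ is either $g(s)=\mathrm{ReLU}(s)=\max\{s,0\}$ or the sigmoid $g(s)=\sigma(s)=\frac{1}{1+\exp(-s)}$. Stealth attack problem. A classification map $\mathcal{F}:\mathbb{B}_n\to\mathbb{R}$ models an AI system. The owner of the system has a finite validation (verification) set $\mathcal{V}\subset\mathbb{B}_n$, which is kept secret and is unknown to the attacker; its cardinality is bounded from above by a constant $M$, and this bound is known to the attacker. An attack term has the form $\mathfrak{A}(\cdot,(\boldsymbol{w},b))=D\,g((\cdot,\boldsymbol{w})-b)$ with a constant $D>0$ and parameters $\boldsymbol{w}\in\mathbb{R}^n$, $b\in\mathbb{R}$. The attacker seeks to replace $\mathcal{F}$ by $$\mathcal{F}_a(\cdot,(\boldsymbol{w},b))=\mathcal{F}(\cdot)+\mathfrak{A}(\cdot,(\boldsymbol{w},b))$$ such that, for some given $\varepsilon>0$, $\Delta>0$ and an element (target) $\boldsymbol{x}'\in\mathbb{B}_n$, known to the attacker but unknown to the owner of $\mathcal{F}$, the following properties hold: $$|\mathcal{F}(\boldsymbol{x})-\mathcal{F}_a(\boldsymbol{x},(\boldsymbol{w},b))|\le\varepsilon\ \text{ for all }\boldsymbol{x}\in\mathcal{V},\qquad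 \mathcal{F}_a(\boldsymbol{x}',(\boldsymbol{w},b))=\mathcal{F}(\boldsymbol{x}')+\Delta .$$ The term $\mathfrak{A}$ is called a solution of the stealth attack problem if it satisfies these two properties.
   Formalization: κ>0 is required, and κ, D are measurable functions of x'. As D g(...)≥Δ need not give exactly F(x')+Δ, the bound is shown for a solution with some increment Δ'≥Δ, and for exactly Δ when D g(κ(1-γ)/2‖x'‖²)=Δ almost surely. *)

theory Defs
  imports "HOL-Probability.Probability"
begin

definition relu :: "real \<Rightarrow> real" where
  "relu s = max s 0"

definition sigmoid :: "real \<Rightarrow> real" where
  "sigmoid s = 1 / (1 + exp (- s))"

definition uniform_ball :: "(real ^ 'n) measure" where
  "uniform_ball = uniform_measure lborel (cball 0 1)"

definition attack_term ::
    "(real \<Rightarrow> real) \<Rightarrow> real \<Rightarrow> real ^ 'n \<Rightarrow> real \<Rightarrow> real ^ 'n \<Rightarrow> real" where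
  "attack_term g D w b x = D * g (x \<bullet> w - b)"

text \<open>Maps on the unit ball are total functions here; \<open>F\<close> is only evaluated on \<open>V\<close> and at the
  target \<open>x'\<close>, all of which lie in the ball where this predicate is used.\<close>

definition attacked_map ::
    "(real ^ 'n \<Rightarrow> real) \<Rightarrow> (real ^ 'n \<Rightarrow> real) \<Rightarrow> real ^ 'n \<Rightarrow> real" where
  "attacked_map F A x = F x + A x"

definition stealth_attack_solution ::
    "(real ^ 'n \<Rightarrow> real) \<Rightarrow> (real ^ 'n) set \<Rightarrow> real \<Rightarrow> real \<Rightarrow> real ^ 'n \<Rightarrow> (real ^ 'n \<Rightarrow> real) \<Rightarrow> bool" where
  "stealth_attack_solution F V \<epsilon> \<Delta> x' A \<longleftrightarrow>
     (\<forall>x\<in>V. \<bar>F x - attacked_map F A x\<bar> \<le> \<epsilon>) \<and> attacked_map F A x' = F x' + \<Delta>"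

text \<open>The threshold \<open>b\<close> is \<open>\<kappa> (1 + \<gamma>) / 2 \<parallel>x'\<parallel>\<^sup>2\<close>, so at \<open>x'\<close> itself the argument of \<open>g\<close>
  is \<open>\<kappa> (1 - \<gamma>) / 2 \<parallel>x'\<parallel>\<^sup>2\<close>.\<close>

definition stealth_attack ::
    "(real \<Rightarrow> real) \<Rightarrow> real \<Rightarrow> real \<Rightarrow> real \<Rightarrow> real ^ 'n \<Rightarrow> real ^ 'n \<Rightarrow> real" where
  "stealth_attack g \<gamma> \<kappa> D x' =
     attack_term g D (\<kappa> *\<^sub>R x') (\<kappa> * ((1 + \<gamma>) / 2) * (norm x')\<^sup>2)"

end

theory Submission imports Defs begin

text \<open>The attack can only be detected at a validation point \<open>x\<close> if \<open>x \<bullet> x' > \<gamma> \<parallel>x'\<parallel>\<^sup>2\<close>, and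
  completing the square shows that such targets \<open>x'\<close> lie in the ball of radius
  \<open>\<parallel>x\<parallel> / (2 \<gamma>) \<le> 1 / (2 \<gamma>)\<close> centred at \<open>x / (2 \<gamma>)\<close>. By scaling, this ball has relative volume at
  most \<open>(1 / (2 \<gamma>))\<^sup>n\<close>, and the union bound over the at most \<open>M\<close> validation points gives the
  claim.\<close>

lemma mono_relu: "mono relu"
  by (auto simp: mono_def relu_def)

lemma relu_nonneg: "relu s \<ge> 0"
  by (simp add: relu_def)

lemma mono_sigmoid: "mono sigmoid"
  by (auto simp: mono_def sigmoid_def intro!: divide_left_mono add_pos_pos mult_pos_pos)

lemma sigmoid_nonneg: "sigmoid s \<ge> 0"
  by (simp add: sigmoid_def add_nonneg_nonneg)

lemma space_uniform_ball [simp]: "space uniform_ball = UNIV"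
  by (simp add: uniform_ball_def)

lemma sets_uniform_ball [simp, measurable_cong]: "sets uniform_ball = sets borel"
  by (simp add: uniform_ball_def)

lemma emeasure_unit_cball:
  "emeasure lborel (cball (0 :: 'a::euclidean_space) 1) \<noteq> 0"
  "emeasure lborel (cball (0 :: 'a::euclidean_space) 1) \<noteq> \<infinity>"
  by (simp_all add: emeasure_cball unit_ball_vol_pos less_imp_neq[symmetric])

lemma prob_space_uniform_ball: "prob_space (uniform_ball :: (real ^ 'n) measure)"
  unfolding uniform_ball_def using emeasure_unit_cball by (rule prob_space_uniform_measure)

text \<open>The part of the ball outside the unit ball carries no mass, so discarding the
  intersection costs only an inequality. Volume scales as \<open>r ^ CARD('n)\<close>, and the
  volume of the unit ball cancels.\<close>

lemma measure_uniform_ball_cball_le: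
  fixes c :: "real ^ 'n"
  assumes "r \<ge> 0"
  shows "measure uniform_ball (cball c r) \<le> r ^ CARD('n)"
proof -
  have pos: "measure lborel (cball (0 :: real ^ 'n) 1) > 0"
    by (simp add: content_cball unit_ball_vol_pos)
  have "measure uniform_ball (cball c r) =
      measure lborel (cball 0 1 \<inter> cball c r) / measure lborel (cball (0 :: real ^ 'n) 1)"
    unfolding uniform_ball_def by (rule measure_uniform_measure[OF emeasure_unit_cball]) simp
  also have "\<dots> \<le> measure lborel (cball c r) / measure lborel (cball (0 :: real ^ 'n) 1)"
    using pos by (intro divide_right_mono measure_mono_fmeasurable)
      (auto simp: fmeasurable_def emeasure_cball assms)
  also have "\<dots> = r ^ CARD('n)"
    using assms less_imp_neq[OF unit_ball_vol_pos[of "real CARD('n)"]] by (simp add: content_cball)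
  finally show ?thesis .
qed

lemma inner_ge_imp_mem_cball:
  fixes x y :: "'a::real_inner"
  assumes "\<gamma> > 0" and "norm x \<le> 1" and "x \<bullet> y \<ge> \<gamma> * (norm y)\<^sup>2"
  shows "y \<in> cball (x /\<^sub>R (2 * \<gamma>)) (1 / (2 * \<gamma>))"
proof -
  have "(norm (x /\<^sub>R (2 * \<gamma>) - y))\<^sup>2 =
      (norm x)\<^sup>2 / (2 * \<gamma>)\<^sup>2 - (x \<bullet> y) / \<gamma> + (norm y)\<^sup>2"
    using dot_norm_neg[of "x /\<^sub>R (2 * \<gamma>)" y] assms(1)
    by (simp add: power_divide) (simp add: field_simps)
  \<comment> \<open>The centre was chosen so that the excess of the inner product splits off as a
    subtracted term, nonnegative by hypothesis.\<close>
  also have "\<dots> = (norm x / (2 * \<gamma>))\<^sup>2 - (x \<bullet> y - \<gamma> * (norm y)\<^sup>2) / \<gamma>"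
    using assms(1) by (simp only: power_divide diff_divide_distrib) simp
  also have "\<dots> \<le> (norm x / (2 * \<gamma>))\<^sup>2"
    using divide_nonneg_pos[of "x \<bullet> y - \<gamma> * (norm y)\<^sup>2" \<gamma>] assms(1,3) by linarith
  also have "\<dots> \<le> (1 / (2 * \<gamma>))\<^sup>2"
    using assms(1,2) by (intro power_mono divide_right_mono) auto
  finally have "norm (x /\<^sub>R (2 * \<gamma>) - y) \<le> 1 / (2 * \<gamma>)"
    by (rule power2_le_imp_le) (use assms(1) in simp)
  then show ?thesis
    by (simp add: dist_norm)
qed

text \<open>The event involves only \<open>V\<close> and \<gamma>, so the bound is unaffected when
  the gain and the scale of the attack are later chosen depending on the target.\<close>

lemma prob_inner_le:
  fixes V :: "(real ^ 'n) set"
  assumes "finite V" and "V \<subseteq> cball 0 1" and "card V \<le> M" and "\<gamma> > 0"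
  shows "\<P>(y in uniform_ball. \<forall>x\<in>V. x \<bullet> y \<le> \<gamma> * (norm y)\<^sup>2)
    \<ge> 1 - real M * (1 / (2 * \<gamma>)) ^ CARD('n)"
proof -
  interpret prob_space "uniform_ball :: (real ^ 'n) measure"
    by (rule prob_space_uniform_ball)
  let ?B = "\<lambda>x. cball (x /\<^sub>R (2 * \<gamma>)) (1 / (2 * \<gamma>)) :: (real ^ 'n) set"
  let ?G = "{y :: real ^ 'n. \<forall>x\<in>V. x \<bullet> y \<le> \<gamma> * (norm y)\<^sup>2}"
  have [measurable]: "?G \<in> sets borel"
    using assms(1) by measurable
  have "- ?G \<subseteq> (\<Union>x\<in>V. ?B x)"
  proof
    fix y assume "y \<in> - ?G"
    then obtain x where "x \<in> V" "x \<bullet> y > \<gamma> * (norm y)\<^sup>2" by (auto simp: not_le)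
    then have "y \<in> ?B x"
      using assms(2,4) by (intro inner_ge_imp_mem_cball) auto
    with \<open>x \<in> V\<close> show "y \<in> (\<Union>x\<in>V. ?B x)"
      by blast
  qed
  then have "prob (- ?G) \<le> prob (\<Union>x\<in>V. ?B x)"
    using assms(1) by (intro finite_measure_mono) auto
  also have "\<dots> \<le> (\<Sum>x\<in>V. prob (?B x))"
    using assms(1) by (intro finite_measure_subadditive_finite) auto
  also have "\<dots> \<le> (\<Sum>x\<in>V. (1 / (2 * \<gamma>)) ^ CARD('n))"
    using assms(4) by (intro sum_mono measure_uniform_ball_cball_le) simp
  also have "\<dots> \<le> real M * (1 / (2 * \<gamma>)) ^ CARD('n)"
    using assms(3,4) by (simp add: divide_right_mono mult_right_mono)
  finally show ?thesis
    using prob_compl[of ?G] by (simp add: Compl_eq_Diff_UNIV)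
qed

text \<open>The threshold is \<open>k\<close> times the midpoint of
  \<open>\<gamma> * (norm y)\<^sup>2\<close> and \<open>(norm y)\<^sup>2\<close>. Hence the argument
  of \<open>g\<close> at the target is the negative of its value at inner product
  \<open>\<gamma> * (norm y)\<^sup>2\<close>.\<close>

lemma stealth_attack_target:
  "stealth_attack g \<gamma> k d y y = d * g (k * ((1 - \<gamma>) / 2) * (norm y)\<^sup>2)"
proof -
  have "y \<bullet> k *\<^sub>R y - k * ((1 + \<gamma>) / 2) * (norm y)\<^sup>2 = k * ((1 - \<gamma>) / 2) * (norm y)\<^sup>2"
    by (simp add: dot_square_norm field_simps)
  then show ?thesis
    by (simp only: stealth_attack_def attack_term_def)
qed

text \<open>The original map cancels from both requirements, leaving conditions on the attack term
  alone.\<close>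

lemma stealth_attack_solution_iff:
  "stealth_attack_solution F V \<epsilon> \<Delta> y A \<longleftrightarrow> (\<forall>x\<in>V. \<bar>A x\<bar> \<le> \<epsilon>) \<and> A y = \<Delta>"
  by (simp add: stealth_attack_solution_def attacked_map_def)

text \<open>The inner product bound pushes the argument of \<open>g\<close> below the point where
  the response is controlled by \<epsilon>; monotonicity carries the bound over, and nonnegativity
  of \<open>g\<close> supplies the absolute value.\<close>

lemma stealth_attack_le:
  assumes "mono g" and "\<And>s. g s \<ge> 0" and "k > 0" and "d > 0"
    and "d * g (- k * ((1 - \<gamma>) / 2) * (norm y)\<^sup>2) \<le> \<epsilon>" and "x \<bullet> y \<le> \<gamma> * (norm y)\<^sup>2"
  shows "\<bar>stealth_attack g \<gamma> k d y x\<bar> \<le> \<epsilon>"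
proof -
  have "k * (x \<bullet> y) \<le> k * (\<gamma> * (norm y)\<^sup>2)"
    using assms by simp
  then have "x \<bullet> k *\<^sub>R y - k * ((1 + \<gamma>) / 2) * (norm y)\<^sup>2 \<le> - k * ((1 - \<gamma>) / 2) * (norm y)\<^sup>2"
    by (simp add: field_simps)
  then have "d * g (x \<bullet> k *\<^sub>R y - k * ((1 + \<gamma>) / 2) * (norm y)\<^sup>2) \<le> \<epsilon>"
    using assms(1,4,5) by (meson monoD mult_left_mono less_imp_le order_trans)
  then show ?thesis
    using assms(2,4) by (simp add: stealth_attack_def attack_term_def)
qed

text \<open>The parameters only guarantee a response of at least \<Delta>, so the first conjunct
  lets the target shift be some \<Delta>' \<ge> \<Delta>, and the second obtains exactly \<Delta>
  when the response equals it. The conditions are imposed almost everywhere since at the origin ReLU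
  gives response 0 < \<Delta>.\<close>

theorem theorem2:
  fixes F :: "real ^ 'n \<Rightarrow> real" and V :: "(real ^ 'n) set" and M :: nat
    and g :: "real \<Rightarrow> real" and \<epsilon> \<Delta> \<gamma> :: real
    and \<kappa> D :: "real ^ 'n \<Rightarrow> real"
  assumes "g = relu \<or> g = sigmoid"
    and "finite V" and "V \<subseteq> cball 0 1" and "card V \<le> M"
    and "\<epsilon> > 0" and "\<Delta> > 0" and "0 < \<gamma>" and "\<gamma> < 1"
    and "\<kappa> \<in> borel_measurable borel" and "D \<in> borel_measurable borel"
    and "AE x' in uniform_ball. \<kappa> x' > 0 \<and> D x' > 0 \<and>
           D x' * g (- \<kappa> x' * ((1 - \<gamma>) / 2) * (norm x')\<^sup>2) \<le> \<epsilon> \<and>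
           D x' * g (\<kappa> x' * ((1 - \<gamma>) / 2) * (norm x')\<^sup>2) \<ge> \<Delta>"
  shows "\<P>(x' in uniform_ball. \<exists>\<Delta>'\<ge>\<Delta>.
             stealth_attack_solution F V \<epsilon> \<Delta>' x' (stealth_attack g \<gamma> (\<kappa> x') (D x') x'))
           \<ge> 1 - real M * (1 / (2 * \<gamma>)) ^ CARD('n) \<and>
         ((AE x' in uniform_ball. D x' * g (\<kappa> x' * ((1 - \<gamma>) / 2) * (norm x')\<^sup>2) = \<Delta>) \<longrightarrow>
          \<P>(x' in uniform_ball.
             stealth_attack_solution F V \<epsilon> \<Delta> x' (stealth_attack g \<gamma> (\<kappa> x') (D x') x'))
           \<ge> 1 - real M * (1 / (2 * \<gamma>)) ^ CARD('n))"
proof -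
  interpret prob_space "uniform_ball :: (real ^ 'n) measure"
    by (rule prob_space_uniform_ball)
  \<comment> \<open>These two properties treat both activations at once; monotonicity also yields
    Borel measurability.\<close>
  have mono: "mono g" and nonneg: "\<And>s. g s \<ge> 0"
    using assms(1) mono_relu mono_sigmoid relu_nonneg sigmoid_nonneg by auto
  note [measurable] = borel_measurable_mono[OF mono] assms(9,10)
  note [simp] = assms(2)
  let ?A = "\<lambda>y. stealth_attack g \<gamma> (\<kappa> y) (D y) y"
  let ?G = "{y. \<forall>x\<in>V. x \<bullet> y \<le> \<gamma> * (norm y)\<^sup>2}"
  have meas [measurable]: "(\<lambda>y. ?A y x) \<in> borel_measurable borel" for x
    unfolding stealth_attack_def attack_term_def by measurable
  \<comment> \<open>On the diagonal the evaluation point varies too, so this is not an instance of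
    \<open>meas\<close>.\<close>
  have meas_target [measurable]: "(\<lambda>y. ?A y y) \<in> borel_measurable borel"
    unfolding stealth_attack_def attack_term_def by measurable
  have good: "AE y in uniform_ball. y \<in> ?G \<longrightarrow> (\<forall>x\<in>V. \<bar>?A y x\<bar> \<le> \<epsilon>) \<and> ?A y y \<ge> \<Delta>"
    using assms(11)
  proof eventually_elim
    case (elim y)
    then show ?case
      by (auto simp: stealth_attack_target intro!: stealth_attack_le[OF mono nonneg])
  qed
  have "prob ?G \<ge> 1 - real M * (1 / (2 * \<gamma>)) ^ CARD('n)"
    using prob_inner_le[OF assms(2-4,7)] by simp
  \<comment> \<open>Both conjuncts follow from this transfer. Measurability of \<open>P\<close>
    matters because \<open>measure\<close> is 0 on non-measurable sets.\<close>
  then have bound: "\<P>(y in uniform_ball. P y) \<ge> 1 - real M * (1 / (2 * \<gamma>)) ^ CARD('n)"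
    if "AE y in uniform_ball. y \<in> ?G \<longrightarrow> P y" and "Measurable.pred borel P" for P
    using finite_measure_mono_AE[of ?G "{y. P y}"] that by (simp add: pred_def)
  have "\<P>(y in uniform_ball. \<exists>\<Delta>'\<ge>\<Delta>. stealth_attack_solution F V \<epsilon> \<Delta>' y (?A y))
      \<ge> 1 - real M * (1 / (2 * \<gamma>)) ^ CARD('n)"
    unfolding stealth_attack_solution_iff
  proof (rule bound)
    show "AE y in uniform_ball. y \<in> ?G \<longrightarrow> (\<exists>\<Delta>'\<ge>\<Delta>. (\<forall>x\<in>V. \<bar>?A y x\<bar> \<le> \<epsilon>) \<and> ?A y y = \<Delta>')"
      using good by eventually_elim auto
    \<comment> \<open>The quantifier over the uncountably many \<Delta>' is eliminated through its
      only possible witness, \<open>?A y y\<close>.\<close>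
    have "Measurable.pred borel (\<lambda>y. (\<forall>x\<in>V. \<bar>?A y x\<bar> \<le> \<epsilon>) \<and> ?A y y \<ge> \<Delta>)"
      by measurable
    then show "Measurable.pred borel (\<lambda>y. \<exists>\<Delta>'\<ge>\<Delta>. (\<forall>x\<in>V. \<bar>?A y x\<bar> \<le> \<epsilon>) \<and> ?A y y = \<Delta>')"
      by (rule back_subst) auto
  qed
  moreover have "\<P>(y in uniform_ball. stealth_attack_solution F V \<epsilon> \<Delta> y (?A y))
      \<ge> 1 - real M * (1 / (2 * \<gamma>)) ^ CARD('n)"
    if "AE y in uniform_ball. D y * g (\<kappa> y * ((1 - \<gamma>) / 2) * (norm y)\<^sup>2) = \<Delta>"
    unfolding stealth_attack_solution_iff
  proof (rule bound)
    show "AE y in uniform_ball. y \<in> ?G \<longrightarrow> (\<forall>x\<in>V. \<bar>?A y x\<bar> \<le> \<epsilon>) \<and> ?A y y = \<Delta>"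
      using good that by eventually_elim (auto simp: stealth_attack_target)
    show "Measurable.pred borel (\<lambda>y. (\<forall>x\<in>V. \<bar>?A y x\<bar> \<le> \<epsilon>) \<and> ?A y y = \<Delta>)"
      by measurable
  qed
  ultimately show ?thesis
    by blast
qed

end
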